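(* Let $g(z)=z+\sum_{n\ge 2}g_nz^n\in\mathbb{A}$, write $[n]_g=g_n$, and let $\phi(z)=1+B_1z+B_2z^2+\cdots$ be as in the context. If $f(z)=z+\sum_{n\ge2}a_nz^n\in\mathbb{A}$ belongs to $\mathcal{S}^{\ast}_g(\phi)$, then the Hankel determinant $\mathcal{H}_2(1)=\begin{vmatrix} 1 & a_2 \\ a_2 & a_3 \end{vmatrix}=a_3-a_2^2$ satisfies $$|\mathcal{H}_2(1)|\le \frac{B_1}{[3]_g-1}\max\left\{1,\left|\frac{B_2}{B_1}+\frac{B_1}{[2]_g-1}\left(1-\frac{[3]_g-1}{[2]_g-1}\right)\right|\right\}.$$
   Context: $\mathbb{U}=\{z\in\mathbb{C}:|z|<1\}$, and $\mathbb{A}$ is the set of analytic functions $f$ on $\mathbb{U}$ with $f(0)=0$, $f'(0)=1$, i.e. $f(z)=z+\sum_{n\ge2}a_nz^n$. For analytic $F,\phi$ on $\mathbb{U}$, $F\prec\phi$ (subordination) means there is an analytic $u$ on $\mathbb{U}$ with $u(0)=0$, $|u(z)|<1$ and $F(z)=\phi(u(z))$ for all $z\in\mathbb{U}$. For $g(z)=z+\sum_{n\ge2}g_nz^n\in\mathbb{A}$, the $g$-derivative of $f\in\mathbb{A}$ is $D_gf(z)=\frac1z\left(z+\sum_{n\ge2}[n]_ga_nz^n\right)$, where $[n]_g=g_n$ (so $zD_gf$ is the convolution, i.e. Hadamard product, of $f$ and $g$). The function $\phi$ is analytic on $\mathbb{U}$ with positive real part, $\phi(0)=1$, $\phi'(0)>0$,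 $\phi(\mathbb{U})$ symmetric with respect to the real axis, with expansion $\phi(z)=1+B_1z+B_2z^2+B_3z^3+\cdots$, $B_1>0$. The class $\mathcal{S}^{\ast}_g(\phi)$ consists of all $f\in\mathbb{A}$ such that $\frac{zD_gf(z)}{f(z)}\prec\phi(z)$.
   Formalization: The prefactor is taken as B_1/|[3]_g-1|, and [2]_g≠1, [3]_g≠1 are assumed; as printed the bound is negative (hence false) for real [3]_g<1, has no meaning for non-real [3]_g, and is undefined when [2]_g=1 or [3]_g=1. For real [3]_g>1 and [2]_g≠1 it is the printed bound. *)

theory Defs
  imports "HOL-Complex_Analysis.Complex_Analysis"
begin

abbreviation unit_disc :: "complex set" ("\<U>") where
  "\<U> \<equiv> ball 0 1"

abbreviation tcoeff :: "(complex \<Rightarrow> complex) \<Rightarrow> nat \<Rightarrow> complex" where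
  "tcoeff f n \<equiv> fps_nth (fps_expansion f 0) n"

definition class_A :: "(complex \<Rightarrow> complex) set" where
  "class_A = {f. f holomorphic_on \<U> \<and> f 0 = 0 \<and> deriv f 0 = 1}"

definition subordinate :: "(complex \<Rightarrow> complex) \<Rightarrow> (complex \<Rightarrow> complex) \<Rightarrow> bool"
    (infix "\<prec>\<^sub>U" 50) where
  "F \<prec>\<^sub>U \<phi> \<longleftrightarrow> F holomorphic_on \<U> \<and> \<phi> holomorphic_on \<U> \<and>
     (\<exists>u. u holomorphic_on \<U> \<and> u 0 = 0 \<and>
          (\<forall>z\<in>\<U>. norm (u z) < 1 \<and> F z = \<phi> (u z)))"

text \<open>
  The value at the origin is that of the analytic continuation; the formula itself
  would read \<open>0 / 0\<close> there.
\<close>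

definition gderiv :: "(complex \<Rightarrow> complex) \<Rightarrow> (complex \<Rightarrow> complex) \<Rightarrow> complex \<Rightarrow> complex" where
  "gderiv g f z =
     (if z = 0 then 1
      else 1 / z * (z + (\<Sum>n. tcoeff g (n + 2) * tcoeff f (n + 2) * z ^ (n + 2))))"

text \<open>
  The coefficients \<open>B\<^sub>n = tcoeff \<phi> n\<close> with \<open>n \<ge> 2\<close> may be complex: \<open>\<phi>\<close> is not
  assumed univalent, so the symmetry of its image does not make them real.
\<close>

definition admissible_phi :: "(complex \<Rightarrow> complex) \<Rightarrow> bool" where
  "admissible_phi \<phi> \<longleftrightarrow> \<phi> holomorphic_on \<U> \<and> (\<forall>z\<in>\<U>. Re (\<phi> z) > 0) \<and> \<phi> 0 = 1 \<and>
     deriv \<phi> 0 \<in> \<real> \<and> Re (deriv \<phi> 0) > 0 \<and> cnj ` (\<phi> ` \<U>) = \<phi> ` \<U>"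

text \<open>
  The quotient \<open>z D\<^sub>g f(z) / f(z)\<close> is undefined at the zeros of \<open>f\<close>, in particular at
  the origin, and is understood with its removable singularities removed. At a pole
  \<^const>\<open>remove_sings\<close> is discontinuous, so the holomorphy demanded by
  subordination says exactly that the quotient extends analytically to the disc.
\<close>

definition starlike_class ::
    "(complex \<Rightarrow> complex) \<Rightarrow> (complex \<Rightarrow> complex) \<Rightarrow> (complex \<Rightarrow> complex) set" where
  "starlike_class g \<phi> =
     {f \<in> class_A. remove_sings (\<lambda>z. z * gderiv g f z / f z) \<prec>\<^sub>U \<phi>}"

definition hankel2 :: "(complex \<Rightarrow> complex) \<Rightarrow> nat \<Rightarrow> complex" where
  "hankel2 f n = det (vector [vector [tcoeff f n, tcoeff f (n + 1)],
                              vector [tcoeff f (n + 1), tcoeff f (n + 2)]] :: complex^2^2)"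

lemma hankel2_1:
  assumes "f \<in> class_A"
  shows "hankel2 f 1 = tcoeff f 3 - (tcoeff f 2)\<^sup>2"
  using assms
  by (simp add: hankel2_def class_A_def det_2 fps_expansion_def power2_eq_square numeral_eq_Suc)

lemma tcoeff_phi_1:
  assumes "admissible_phi \<phi>"
  shows "tcoeff \<phi> 1 = of_real (Re (tcoeff \<phi> 1))" and "Re (tcoeff \<phi> 1) > 0"
  using assms by (auto simp: admissible_phi_def fps_expansion_def)

end

theory Submission
  imports Defs
begin

text \<open>
  Write \<open>p(z) = z D\<^sub>g f(z) / f(z)\<close>, singularities removed. Since \<open>p = \<phi> \<circ> u\<close> with a
  Schwarz function \<open>u(z) = u\<^sub>1 z + u\<^sub>2 z\<^sup>2 + \<dots>\<close>,
  its expansion begins \<open>1 + B\<^sub>1 u\<^sub>1 z + (B\<^sub>1 u\<^sub>2 + B\<^sub>2 u\<^sub>1\<^sup>2) z\<^sup>2\<close>. Near the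
  origin \<open>p f\<close> is the Hadamard product of \<open>f\<close> and \<open>g\<close>
  (\<open>starlike_functional_equation\<close>), and comparing coefficients gives
  (\<open>starlike_coeffs\<close>)
  \<open>([2]\<^sub>g - 1) a\<^sub>2 = B\<^sub>1 u\<^sub>1\<close> and
  \<open>([3]\<^sub>g - 1) a\<^sub>3 = B\<^sub>1 u\<^sub>1 a\<^sub>2 + B\<^sub>1 u\<^sub>2 + B\<^sub>2 u\<^sub>1\<^sup>2\<close>.
  Eliminating \<open>a\<^sub>2\<close> turns \<open>a\<^sub>3 - a\<^sub>2\<^sup>2\<close> into
  \<open>B\<^sub>1 / ([3]\<^sub>g - 1) \<cdot> (u\<^sub>2 + t u\<^sub>1\<^sup>2)\<close>,
  where \<open>t\<close> is the complex number whose modulus occurs in the bound.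

  What remains is the inequality \<open>\<bar>u\<^sub>2 + t u\<^sub>1\<^sup>2\<bar> \<le> max 1 \<bar>t\<bar>\<close> of Keogh and Merkes. It follows
  from \<open>\<bar>u\<^sub>2\<bar> \<le> 1 - \<bar>u\<^sub>1\<bar>\<^sup>2\<close>, which is the Schwarz--Pick inequality at the origin for the
  function \<open>u(z) / z\<close>.
\<close>

section \<open>Coefficients of Schwarz functions\<close>

lemma has_fps_expansion_unit_disc:
  assumes "f holomorphic_on ball 0 1"
  shows "f has_fps_expansion fps_expansion f 0"
  by (rule has_fps_expansion_fps_expansion[of "ball 0 1"]) (use assms in auto)

lemma eventually_nhds_0_unit_disc:
  fixes P :: "complex \<Rightarrow> bool"
  assumes "\<And>z. norm z < 1 \<Longrightarrow> P z"
  shows "eventually P (nhds 0)"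
  using assms eventually_nhds_in_open[of "ball 0 1 :: complex set" 0]
  by (auto elim!: eventually_mono)

text \<open>
  Composing \<open>v\<close> with the disc automorphism that moves \<open>v 0\<close> to the origin reduces this to the
  Schwarz lemma; the derivative of that automorphism at \<open>v 0\<close> is \<open>1 / (1 - \<bar>v 0\<bar>\<^sup>2)\<close>.
\<close>

lemma Schwarz_Pick_deriv_0:
  assumes holf: "v holomorphic_on ball 0 1" and bnd: "\<And>z. norm z < 1 \<Longrightarrow> norm (v z) < 1"
  shows "norm (deriv v 0) \<le> 1 - (norm (v 0))\<^sup>2"
proof -
  define w where "w = v 0"
  define M where "M = Moebius_function 0 w \<circ> v"
  have w: "norm w < 1" using bnd[of 0] by (simp add: w_def)
  hence pos: "1 - (norm w)\<^sup>2 > 0" by (simp add: abs_square_less_1)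
  have sq: "1 - cnj w * w = of_real (1 - (norm w)\<^sup>2)"
    by (simp add: complex_norm_square mult.commute del: of_real_power)
  have nz: "1 - cnj w * w \<noteq> 0"
    unfolding sq using pos by (simp only: of_real_eq_0_iff)
  have holM: "M holomorphic_on ball 0 1"
    unfolding M_def
    by (rule holomorphic_on_compose_gen[OF holf Moebius_function_holomorphic[OF w]])
       (auto intro: bnd)
  have "norm (deriv M 0) \<le> 1"
  proof (rule Schwarz_Lemma(2)[OF holM _ _, of 0])
    show "M 0 = 0" by (simp add: M_def w_def Moebius_function_eq_zero)
    show "norm (M z) < 1" if "norm z < 1" for z
      using Moebius_function_norm_lt_1[OF w bnd[OF that]] by (simp add: M_def)
  qed auto
  moreover have "deriv M 0 = deriv v 0 / (1 - cnj w * w)"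
  proof -
    have v': "(v has_field_derivative deriv v 0) (at 0)"
      using holf by (auto intro!: holomorphic_derivI[of _ "ball 0 1"])
    have "(M has_field_derivative
             ((deriv v 0 * (1 - cnj w * v 0) - (v 0 - w) * (- (cnj w * deriv v 0)))
               / ((1 - cnj w * v 0) * (1 - cnj w * v 0)))) (at 0)"
      unfolding M_def o_def Moebius_function_simple
      using nz by (auto intro!: derivative_eq_intros v' simp: w_def)
    thus ?thesis
      using nz by (simp add: DERIV_imp_deriv w_def)
  qed
  ultimately have "norm (deriv v 0) / (1 - (norm w)\<^sup>2) \<le> 1"
    unfolding sq using pos by (simp only: norm_divide norm_of_real abs_of_pos)
  thus ?thesis using pos by (simp add: w_def)
qed

text \<open>
  The coefficients \<open>u\<^sub>1, u\<^sub>2\<close> are the value and the derivative at the origin of \<open>h(z) = u(z) / z\<close>.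
  By the Schwarz lemma \<open>h\<close> maps the disc into itself unless \<open>u\<close> is a rotation, and for a
  rotation both sides vanish.
\<close>

lemma Schwarz_second_coeff:
  assumes holu: "u holomorphic_on ball 0 1" and u0: "u 0 = 0"
    and bnd: "\<And>z. norm z < 1 \<Longrightarrow> norm (u z) < 1"
  shows "norm (tcoeff u 2) \<le> 1 - (norm (tcoeff u 1))\<^sup>2"
proof -
  obtain h where holh: "h holomorphic_on ball 0 1"
    and uh: "\<And>z. norm z < 1 \<Longrightarrow> u z = z * h z" and h0: "deriv u 0 = h 0"
    using Schwarz3[OF holu u0] by blast
  have "fps_expansion u 0 = fps_expansion (\<lambda>z. z * h z) 0"
    by (intro fps_expansion_cong eventually_nhds_0_unit_disc uh)
  also have "\<dots> = fps_X * fps_expansion h 0"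
    by (intro fps_expansion_eqI fps_expansion_intros has_fps_expansion_unit_disc holh)
  finally have eq: "fps_expansion u 0 = fps_X * fps_expansion h 0" .
  have u1: "tcoeff u 1 = h 0" and u2: "tcoeff u 2 = deriv h 0"
    by (simp_all add: eq) (simp_all add: fps_expansion_def)
  show ?thesis
  proof (cases "\<exists>\<alpha>. (\<forall>z. norm z < 1 \<longrightarrow> u z = \<alpha> * z) \<and> norm \<alpha> = 1")
    case True
    then obtain \<alpha> where \<alpha>: "\<And>z. norm z < 1 \<Longrightarrow> u z = \<alpha> * z" "norm \<alpha> = 1" by blast
    have "fps_expansion u 0 = fps_expansion (\<lambda>z. \<alpha> * z) 0"
      by (intro fps_expansion_cong eventually_nhds_0_unit_disc \<alpha>)
    also have "\<dots> = fps_const \<alpha> * fps_X"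
      by (intro fps_expansion_eqI fps_expansion_intros)
    finally have "fps_expansion u 0 = fps_const \<alpha> * fps_X" .
    thus ?thesis using \<alpha>(2) by simp
  next
    case False
    have "norm (h z) < 1" if z: "norm z < 1" for z
    proof (cases "z = 0")
      case True
      have "norm (deriv u 0) \<le> 1" "norm (deriv u 0) \<noteq> 1"
        using Schwarz_Lemma(2,3)[OF holu u0 bnd, of 0] False by auto
      thus ?thesis using h0 True by simp
    next
      case nz: False
      have "norm (u z) \<le> norm z" "norm (u z) \<noteq> norm z"
        using Schwarz_Lemma(1,3)[OF holu u0 bnd, of z] False z nz by auto
      thus ?thesis using uh[OF z] nz by (simp add: norm_mult)
    qed
    from Schwarz_Pick_deriv_0[OF holh this] show ?thesis by (simp add: u1[simplified] u2)
  qed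
qed

text \<open>
  With \<open>x = \<bar>u\<^sub>1\<bar>\<^sup>2 \<in> [0, 1]\<close>, the bound on \<open>u\<^sub>2\<close> leaves the convex combination
  \<open>(1 - x) \<cdot> 1 + x \<cdot> \<bar>t\<bar>\<close>.
\<close>

lemma Keogh_Merkes:
  assumes "u holomorphic_on ball 0 1" "u 0 = 0" "\<And>z. norm z < 1 \<Longrightarrow> norm (u z) < 1"
  shows "norm (tcoeff u 2 + t * (tcoeff u 1)\<^sup>2) \<le> max 1 (norm t)"
proof -
  define x where "x = (norm (tcoeff u 1))\<^sup>2"
  have le: "norm (tcoeff u 2) \<le> 1 - x"
    unfolding x_def by (rule Schwarz_second_coeff[OF assms])
  have x: "0 \<le> x" "x \<le> 1"
    using le norm_ge_zero[of "tcoeff u 2"] unfolding x_def by (simp, linarith)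
  have "norm (tcoeff u 2 + t * (tcoeff u 1)\<^sup>2) \<le> norm (tcoeff u 2) + norm t * x"
    by (rule order_trans[OF norm_triangle_ineq]) (simp add: norm_mult norm_power x_def)
  also have "\<dots> \<le> (1 - x) * 1 + x * norm t" using le by (simp add: mult.commute)
  also have "\<dots> \<le> (1 - x) * max 1 (norm t) + x * max 1 (norm t)"
    using x by (intro add_mono mult_left_mono) auto
  finally show ?thesis by (simp add: algebra_simps)
qed

section \<open>The Hadamard product and the functional equation\<close>

text \<open>
  \<^const>\<open>gderiv\<close> is given by an infinite sum, which has its meaning only where the series
  converges. If both factors converge at \<open>r\<close>, the terms of one are bounded there and those of
  the other absolutely summable, so the Hadamard product converges at \<open>r\<^sup>2\<close>.
\<close>

lemma hadamard_conv_radius_pos: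
  fixes F G :: "'a :: {banach, real_normed_field} fps"
  assumes "fps_conv_radius F > 0" "fps_conv_radius G > 0"
  shows "fps_conv_radius (Abs_fps (\<lambda>n. fps_nth G n * fps_nth F n)) > 0"
proof -
  have "0 < min (fps_conv_radius F) (fps_conv_radius G)" using assms by simp
  then obtain r where r: "0 < ereal r" "ereal r < min (fps_conv_radius F) (fps_conv_radius G)"
    using ereal_dense2 by blast
  have F: "summable (\<lambda>n. norm (fps_nth F n * of_real r ^ n))"
    and G: "summable (\<lambda>n. norm (fps_nth G n * of_real r ^ n))"
    using r by (auto intro!: norm_summable_fps)
  from G have "bounded (range (\<lambda>n. norm (fps_nth G n * of_real r ^ n)))"
    using convergent_imp_bounded summable_LIMSEQ_zero by blast
  then obtain C where C: "\<And>n. norm (fps_nth G n * of_real r ^ n) \<le> C"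
    by (auto simp: bounded_iff)
  have "summable (\<lambda>n. (fps_nth G n * fps_nth F n) * of_real (r ^ 2) ^ n)"
  proof (rule summable_comparison_test'[of _ 0])
    show "summable (\<lambda>n. C * norm (fps_nth F n * of_real r ^ n))"
      by (intro summable_mult F)
    fix n
    have "norm ((fps_nth G n * fps_nth F n) * of_real (r ^ 2) ^ n) =
       norm (fps_nth G n * of_real r ^ n) * norm (fps_nth F n * of_real r ^ n)"
      by (simp add: norm_mult norm_power power_mult_distrib power2_eq_square)
    also have "\<dots> \<le> C * norm (fps_nth F n * of_real r ^ n)"
      by (intro mult_right_mono C) auto
    finally show "norm ((fps_nth G n * fps_nth F n) * of_real (r ^ 2) ^ n) \<le>
       C * norm (fps_nth F n * of_real r ^ n)" .
  qed
  hence "ereal (norm (of_real (r\<^sup>2) :: 'a)) \<le>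
           fps_conv_radius (Abs_fps (\<lambda>n. fps_nth G n * fps_nth F n))"
    unfolding fps_conv_radius_def by (intro conv_radius_geI) simp
  moreover have "0 < ereal (norm (of_real (r\<^sup>2) :: 'a))" using r by simp
  ultimately show ?thesis by (rule less_le_trans[rotated])
qed

lemma class_A_coeffs:
  assumes "f \<in> class_A"
  shows "tcoeff f 0 = 0" "tcoeff f (Suc 0) = 1"
  using assms by (auto simp: class_A_def fps_expansion_def)

lemma gderiv_expansion:
  assumes f: "f \<in> class_A" and g: "g \<in> class_A"
  shows "(\<lambda>z. z * gderiv g f z) has_fps_expansion Abs_fps (\<lambda>n. tcoeff g n * tcoeff f n)"
    (is "_ has_fps_expansion ?H")
proof -
  have "f has_fps_expansion fps_expansion f 0" "g has_fps_expansion fps_expansion g 0"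
    using f g by (auto intro: has_fps_expansion_unit_disc simp: class_A_def)
  hence R: "fps_conv_radius ?H > 0"
    by (intro hadamard_conv_radius_pos) (auto simp: has_fps_expansion_def)
  have "eval_fps ?H z = z * gderiv g f z" if z: "norm z < fps_conv_radius ?H" for z
  proof -
    have "eval_fps ?H z = (\<Sum>n. tcoeff g (n+2) * tcoeff f (n+2) * z ^ (n+2))
            + (\<Sum>n<2. tcoeff g n * tcoeff f n * z ^ n)"
      using suminf_split_initial_segment[OF summable_fps[OF z], of 2] by (simp add: eval_fps_def)
    also have "(\<Sum>n<2. tcoeff g n * tcoeff f n * z ^ n) = z"
      by (simp add: numeral_2_eq_2 class_A_coeffs[OF f] class_A_coeffs[OF g])
    finally show ?thesis by (cases "z = 0") (simp_all add: gderiv_def eval_fps_at_0 add.commute)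
  qed
  moreover have "eventually (\<lambda>z. z \<in> eball 0 (fps_conv_radius ?H)) (nhds 0)"
    using R by (intro eventually_nhds_in_open) (auto simp: zero_ereal_def)
  ultimately show ?thesis
    unfolding has_fps_expansion_def using R by (auto elim!: eventually_mono)
qed

text \<open>
  The equation \<open>p f = z D\<^sub>g f\<close> is clear only off the zeros of \<open>f\<close>, one of which is the origin.
  Passing to Laurent expansions at the origin avoids this exception: removing singularities does
  not change a Laurent expansion, and in the field of Laurent series one may multiply by \<open>f\<close>.
\<close>

lemma starlike_functional_equation:
  assumes f: "f \<in> class_A" and g: "g \<in> class_A"
    and holp: "remove_sings (\<lambda>z. z * gderiv g f z / f z) holomorphic_on ball 0 1"
  shows "fps_expansion (remove_sings (\<lambda>z. z * gderiv g f z / f z)) 0 * fps_expansion f 0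
           = Abs_fps (\<lambda>n. tcoeff g n * tcoeff f n)"
    (is "?P * ?F = ?H")
proof -
  have F0: "?F \<noteq> 0" using class_A_coeffs(2)[OF f] by auto
  have "(\<lambda>z. z * gderiv g f z / f z) has_laurent_expansion fps_to_fls ?H / fps_to_fls ?F"
    using f by (intro laurent_expansion_intros has_laurent_expansion_fps gderiv_expansion
        has_fps_expansion_unit_disc g) (auto simp: class_A_def)
  hence "remove_sings (\<lambda>z. z * gderiv g f z / f z)
           has_laurent_expansion fps_to_fls ?H / fps_to_fls ?F"
    by (rule remove_sings_has_laurent_expansion)
  moreover have "remove_sings (\<lambda>z. z * gderiv g f z / f z) has_laurent_expansion fps_to_fls ?P"
    by (intro has_laurent_expansion_fps has_fps_expansion_unit_disc holp)
  ultimately have "fps_to_fls ?P = fps_to_fls ?H / fps_to_fls ?F"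
    using has_laurent_expansion_unique by blast
  hence "fps_to_fls (?P * ?F) = fps_to_fls ?H"
    using F0 by (simp add: fls_times_fps_to_fls)
  thus ?thesis by (simp only: fps_to_fls_eq_iff)
qed

lemma starlike_coeffs:
  assumes f: "f \<in> class_A" and g: "g \<in> class_A"
    and holp: "remove_sings (\<lambda>z. z * gderiv g f z / f z) holomorphic_on ball 0 1"
    and hol\<phi>: "\<phi> holomorphic_on ball 0 1" and \<phi>0: "\<phi> 0 = 1"
    and holu: "u holomorphic_on ball 0 1" and u0: "u 0 = 0"
    and sub: "\<And>z. z \<in> ball 0 1 \<Longrightarrow> remove_sings (\<lambda>z. z * gderiv g f z / f z) z = \<phi> (u z)"
  shows "(tcoeff g 2 - 1) * tcoeff f 2 = tcoeff \<phi> 1 * tcoeff u 1"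
    and "(tcoeff g 3 - 1) * tcoeff f 3 =
           tcoeff \<phi> 1 * tcoeff u 1 * tcoeff f 2 +
           tcoeff \<phi> 1 * tcoeff u 2 + tcoeff \<phi> 2 * (tcoeff u 1)\<^sup>2"
proof -
  let ?p = "remove_sings (\<lambda>z. z * gderiv g f z / f z)"
  let ?P = "fps_expansion ?p 0" and ?F = "fps_expansion f 0"
  let ?U = "fps_expansion u 0" and ?\<Phi> = "fps_expansion \<phi> 0"
  have U0: "fps_nth ?U 0 = 0" and \<Phi>0: "fps_nth ?\<Phi> 0 = 1"
    using u0 \<phi>0 by (simp_all add: fps_expansion_def)
  have "?P = fps_expansion (\<phi> \<circ> u) 0"
    by (intro fps_expansion_cong eventually_nhds_0_unit_disc) (simp add: sub)
  also have "\<dots> = ?\<Phi> oo ?U"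
    by (intro fps_expansion_eqI has_fps_expansion_compose has_fps_expansion_unit_disc
        hol\<phi> holu U0)
  finally have P: "?P = ?\<Phi> oo ?U" .
  have P0: "fps_nth ?P 0 = 1" by (simp add: P \<Phi>0)
  have P1: "fps_nth ?P 1 = tcoeff \<phi> 1 * tcoeff u 1"
    by (simp add: P fps_compose_nth)
  have P2: "fps_nth ?P 2 = tcoeff \<phi> 1 * tcoeff u 2 + tcoeff \<phi> 2 * (tcoeff u 1)\<^sup>2"
    by (simp add: P fps_compose_nth numeral_2_eq_2 fps_mult_nth U0 power2_eq_square)
  have H: "(\<Sum>i=0..n. fps_nth ?P i * tcoeff f (n - i)) = tcoeff g n * tcoeff f n" for n
    using arg_cong[OF starlike_functional_equation[OF f g holp], of "\<lambda>X. fps_nth X n"]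
    by (simp add: fps_mult_nth)
  have F: "tcoeff f 0 = 0" "tcoeff f 1 = 1" using class_A_coeffs[OF f] by simp_all
  show "(tcoeff g 2 - 1) * tcoeff f 2 = tcoeff \<phi> 1 * tcoeff u 1"
    using H[of 2] P0 P1 F by (simp add: numeral_eq_Suc algebra_simps)
  show "(tcoeff g 3 - 1) * tcoeff f 3 =
           tcoeff \<phi> 1 * tcoeff u 1 * tcoeff f 2 +
           tcoeff \<phi> 1 * tcoeff u 2 + tcoeff \<phi> 2 * (tcoeff u 1)\<^sup>2"
    using H[of 3] P0 P1 P2 F by (simp add: numeral_eq_Suc algebra_simps)
qed

section \<open>The Hankel determinant\<close>

theorem theorem2p25:
  fixes f g \<phi> :: "complex \<Rightarrow> complex"
  assumes "g \<in> class_A"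
    and "admissible_phi \<phi>"
    and "tcoeff g 2 \<noteq> 1" and "tcoeff g 3 \<noteq> 1"
    and "f \<in> starlike_class g \<phi>"
  shows "norm (hankel2 f 1) \<le>
           Re (tcoeff \<phi> 1) / norm (tcoeff g 3 - 1) *
             max 1 (norm (tcoeff \<phi> 2 / tcoeff \<phi> 1 +
                          tcoeff \<phi> 1 / (tcoeff g 2 - 1) *
                            (1 - (tcoeff g 3 - 1) / (tcoeff g 2 - 1))))"
proof -
  have f: "f \<in> class_A"
    and "remove_sings (\<lambda>z. z * gderiv g f z / f z) \<prec>\<^sub>U \<phi>"
    using assms(5) by (auto simp: starlike_class_def)
  then obtain u where
    hol: "remove_sings (\<lambda>z. z * gderiv g f z / f z) holomorphic_on \<U>"
      "\<phi> holomorphic_on \<U>" "u holomorphic_on \<U>" and u0: "u 0 = 0" and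
    bnd: "\<And>z. z \<in> \<U> \<Longrightarrow> norm (u z) < 1" and
    sub: "\<And>z. z \<in> \<U> \<Longrightarrow> remove_sings (\<lambda>z. z * gderiv g f z / f z) z = \<phi> (u z)"
    unfolding subordinate_def by blast
  have \<phi>0: "\<phi> 0 = 1" using assms(2) by (simp add: admissible_phi_def)
  define B1 B2 c d u1 u2 a2 a3 where defs: "B1 = tcoeff \<phi> 1" "B2 = tcoeff \<phi> 2"
    "c = tcoeff g 2 - 1" "d = tcoeff g 3 - 1" "u1 = tcoeff u 1" "u2 = tcoeff u 2"
    "a2 = tcoeff f 2" "a3 = tcoeff f 3"
  have B1: "B1 = of_real (Re B1)" "Re B1 > 0"
    unfolding defs by (rule tcoeff_phi_1[OF assms(2)])+
  have nz: "B1 \<noteq> 0" "c \<noteq> 0" "d \<noteq> 0" using B1(2) assms(3,4) by (auto simp: defs)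
  define t where "t = B2 / B1 + B1 / c * (1 - d / c)"
  have "c * a2 = B1 * u1" "d * a3 = B1 * u1 * a2 + B1 * u2 + B2 * u1\<^sup>2"
    unfolding defs by (rule starlike_coeffs[OF f assms(1) hol(1,2) \<phi>0 hol(3) u0 sub]; assumption)+
  hence a: "a2 = B1 * u1 / c" "a3 = (B1 * u1 * a2 + B1 * u2 + B2 * u1\<^sup>2) / d"
    using nz by (simp_all add: nonzero_eq_divide_eq mult.commute)
  have "hankel2 f 1 = a3 - a2\<^sup>2"
    unfolding defs by (rule hankel2_1[OF f])
  also have "\<dots> = B1 / d * (u2 + t * u1\<^sup>2)"
    unfolding a t_def using nz by (simp add: field_simps power2_eq_square)
  finally have "norm (hankel2 f 1) = norm B1 / norm d * norm (u2 + t * u1\<^sup>2)"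
    by (simp add: norm_mult norm_divide)
  also have "norm B1 = Re B1"
    using B1 by (metis abs_of_pos norm_of_real)
  also have "Re B1 / norm d * norm (u2 + t * u1\<^sup>2) \<le> Re B1 / norm d * max 1 (norm t)"
    unfolding defs(5,6) using B1(2) bnd
    by (intro mult_left_mono Keogh_Merkes hol u0) auto
  finally show ?thesis by (simp only: t_def defs)
qed

end
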